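(* Let $T$ be a $d$-regular rooted tree with $d\ge 2$, and let $G\leq \mathrm{Aut}(T)$ be a finitely generated regular branch group. Suppose that $G$ contains a finite subgroup $Q$ that does not fix any point in $\partial T$ (i.e. there is no $\xi\in\partial T$ fixed by all elements of $Q$). Then there exist uncountably many automorphism equivalence classes of weakly maximal subgroups of $G$, all distinct from the automorphism equivalence classes of parabolic subgroups associated with the action of $G$ on $T$.
   Context: The $d$-regular rooted tree $T$ is the rooted tree in which every vertex has exactly $d$ children; its vertices are identified with finite words over an alphabet of $d$ letters (the root being the empty word). $\mathrm{Aut}(T)$ is the group of root-preserving automorphisms of $T$. Level $n$, denoted $\mathcal L_n$, is the set of vertices at distance $n$ from the root. For a vertex $v$, $T_v$ is the subtree of $T$ consisting of $v$ and all its descendants; it is identified with $T$ via $vw\leftrightarrow w$. For $G\le \mathrm{Aut}(T)$, $\mathrm{Stab}_G(v)$ is the stabilizer of the vertex $v$ and $\mathrm{Stab}_G(n)=\bigcap_{v\in\mathcal L_n}\mathrm{Stab}_G(v)$. Restriction gives maps $\psi_v\colon \mathrm{Stab}_G(v)\to \mathrm{Aut}(T)$, $\phi\mapsto \phi|_{T_v}$, and $\psi_1\colon \mathrm{Stab}_G(1)\to\mathrm{Aut}(T)^d$, $\phi\mapsto(\phi|_{T_{v_1}},\dots,\phi|_{T_{v_d}})$, where $v_1,\dots,v_d$ are the vertices of the first level. $G$ is self-similar if $\psi_v(\mathrm{Stab}_G(v))=G$ for every vertex $v$. $G$ is spherically transitive if it acts transitively on each level. $G$ is regular branch if it is spherically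 transitive, self-similar, and there exists a finite index subgroup $K$ of $G$ such that $K^d$ is contained in $\psi_1(K\cap \mathrm{Stab}_G(1))$ as a subgroup of finite index. The boundary $\partial T$ is the set of infinite rays of $T$ starting at the root; $G$ acts on it. A parabolic subgroup of $G$ (for the action on $T$) is the stabilizer in $G$ of a point of $\partial T$. A subgroup of $G$ is weakly maximal if it is maximal (with respect to inclusion) among the subgroups of infinite index in $G$. Two subgroups of $G$ are automorphism equivalent if some automorphism of the abstract group $G$ maps one onto the other. *)

theory Defs
  imports "HOL-Algebra.Algebra" "HOL-Library.Countable_Set"
begin

section \<open>Automorphisms of the regular rooted tree\<close>

text \<open>
  The \<open>d\<close>-regular rooted tree \<open>T\<close> is represented by the alphabet type \<open>'a\<close> with \<open>d\<close> elements:
  the vertices are the words of type \<open>'a list\<close>, the root is the empty word, the children of \<open>v\<close> are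
  the words \<open>v @ [x]\<close>, and level \<open>n\<close> consists of the words of length \<open>n\<close>.
\<close>

definition tree_adj :: "'a list \<Rightarrow> 'a list \<Rightarrow> bool" where
  "tree_adj v w \<longleftrightarrow> (\<exists>x. w = v @ [x] \<or> v = w @ [x])"

definition tree_automorphism :: "('a list \<Rightarrow> 'a list) \<Rightarrow> bool" where
  "tree_automorphism g \<longleftrightarrow>
     bij g \<and> (\<forall>v w. tree_adj (g v) (g w) \<longleftrightarrow> tree_adj v w) \<and> g [] = []"

definition AutT :: "('a list \<Rightarrow> 'a list) monoid" where
  "AutT = \<lparr>carrier = {g. tree_automorphism g}, monoid.mult = (\<circ>), one = id\<rparr>"

text \<open>A set \<open>G\<close> of tree automorphisms regarded as a group under composition.\<close>

abbreviation grp :: "('a list \<Rightarrow> 'a list) set \<Rightarrow> ('a list \<Rightarrow> 'a list) monoid" where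
  "grp G \<equiv> AutT\<lparr>carrier := G\<rparr>"

definition vertex_stab :: "('a list \<Rightarrow> 'a list) set \<Rightarrow> 'a list \<Rightarrow> ('a list \<Rightarrow> 'a list) set" where
  "vertex_stab G v = {g \<in> G. g v = v}"

definition level_stab :: "('a list \<Rightarrow> 'a list) set \<Rightarrow> nat \<Rightarrow> ('a list \<Rightarrow> 'a list) set" where
  "level_stab G n = {g \<in> G. \<forall>v. length v = n \<longrightarrow> g \<in> vertex_stab G v}"

text \<open>
  For \<open>g\<close> fixing \<open>v\<close>, the restriction of \<open>g\<close> to the subtree \<open>T\<^sub>v\<close> of the words \<open>v @ w\<close>, read as an
  automorphism of \<open>T\<close> through the identification of \<open>v @ w\<close> with \<open>w\<close>. It is only meant for \<open>g\<close>
  fixing \<open>v\<close>.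
\<close>

definition psi :: "'a list \<Rightarrow> ('a list \<Rightarrow> 'a list) \<Rightarrow> 'a list \<Rightarrow> 'a list" where
  "psi v g = (\<lambda>w. drop (length v) (g (v @ w)))"

text \<open>The vertices of the first level are the words \<open>[x]\<close>, so \<open>d\<close>-tuples are indexed by letters.\<close>

definition psi1 :: "('a list \<Rightarrow> 'a list) \<Rightarrow> 'a \<Rightarrow> 'a list \<Rightarrow> 'a list" where
  "psi1 g = (\<lambda>x. psi [x] g)"

definition AutT_pow :: "('a \<Rightarrow> 'a list \<Rightarrow> 'a list) monoid" where
  "AutT_pow = product_group UNIV (\<lambda>_. AutT)"

section \<open>Group-theoretic notions\<close>

definition finitely_generated :: "('g, 'b) monoid_scheme \<Rightarrow> bool" where
  "finitely_generated G \<longleftrightarrow>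
     (\<exists>S. finite S \<and> S \<subseteq> carrier G \<and> generate G S = carrier G)"

definition finite_index :: "'g set \<Rightarrow> ('g, 'b) monoid_scheme \<Rightarrow> bool" where
  "finite_index H G \<longleftrightarrow> subgroup H G \<and> finite (rcosets\<^bsub>G\<^esub> H)"

definition infinite_index :: "'g set \<Rightarrow> ('g, 'b) monoid_scheme \<Rightarrow> bool" where
  "infinite_index H G \<longleftrightarrow> subgroup H G \<and> infinite (rcosets\<^bsub>G\<^esub> H)"

definition weakly_maximal :: "'g set \<Rightarrow> ('g, 'b) monoid_scheme \<Rightarrow> bool" where
  "weakly_maximal H G \<longleftrightarrow>
     infinite_index H G \<and> (\<forall>L. infinite_index L G \<and> H \<subseteq> L \<longrightarrow> L = H)"

definition aut_equiv :: "('g, 'b) monoid_scheme \<Rightarrow> ('g set \<times> 'g set) set" where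
  "aut_equiv G =
     {(H, L). subgroup H G \<and> subgroup L G \<and> (\<exists>\<phi>\<in>iso G G. \<phi> ` H = L)}"

section \<open>Regular branch groups and parabolic subgroups\<close>

definition self_similar :: "('a list \<Rightarrow> 'a list) set \<Rightarrow> bool" where
  "self_similar G \<longleftrightarrow> (\<forall>v. psi v ` vertex_stab G v = G)"

definition spherically_transitive :: "('a list \<Rightarrow> 'a list) set \<Rightarrow> bool" where
  "spherically_transitive G \<longleftrightarrow>
     (\<forall>n v w. length v = n \<and> length w = n \<longrightarrow> (\<exists>g\<in>G. g v = w))"

definition regular_branch :: "('a list \<Rightarrow> 'a list) set \<Rightarrow> bool" where
  "regular_branch G \<longleftrightarrow>
     spherically_transitive G \<and> self_similar G \<and>
     (\<exists>K. finite_index K (grp G) \<and>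
        finite_index (UNIV \<rightarrow>\<^sub>E K) (AutT_pow\<lparr>carrier := psi1 ` (K \<inter> level_stab G 1)\<rparr>))"

text \<open>An infinite ray from the root is given by the sequence of its vertices.\<close>

definition boundary :: "(nat \<Rightarrow> 'a list) set" where
  "boundary = {\<xi>. \<xi> 0 = [] \<and> (\<forall>n. \<exists>x. \<xi> (Suc n) = \<xi> n @ [x])}"

text \<open>The action of \<open>g\<close> on the boundary is \<open>\<xi> \<mapsto> g \<circ> \<xi>\<close>.\<close>

definition boundary_stab ::
  "('a list \<Rightarrow> 'a list) set \<Rightarrow> (nat \<Rightarrow> 'a list) \<Rightarrow> ('a list \<Rightarrow> 'a list) set" where
  "boundary_stab G \<xi> = {g \<in> G. g \<circ> \<xi> = \<xi>}"

definition parabolic :: "('a list \<Rightarrow> 'a list) set \<Rightarrow> ('a list \<Rightarrow> 'a list) set \<Rightarrow> bool" where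
  "parabolic P G \<longleftrightarrow> (\<exists>\<xi>\<in>boundary. P = boundary_stab G \<xi>)"


lemma group_AutT: "group AutT"
proof (rule groupI)
  fix g :: "'a list \<Rightarrow> 'a list"
  assume "g \<in> carrier AutT"
  then have g: "bij g" "\<And>v w. tree_adj (g v) (g w) \<longleftrightarrow> tree_adj v w" "g [] = []"
    by (auto simp: AutT_def tree_automorphism_def)
  have gi: "g (inv_into UNIV g v) = v" "inv_into UNIV g (g v) = v" for v
    using g(1) by (simp_all add: bij_is_surj surj_f_inv_f bij_is_inj)
  have "tree_automorphism (inv_into UNIV g)"
    unfolding tree_automorphism_def
    using g(1) g(2)[of "inv_into UNIV g _" "inv_into UNIV g _"] g(3) gi by (metis bij_imp_bij_inv)
  moreover have "inv_into UNIV g \<circ> g = id"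
    using gi by auto
  ultimately show "\<exists>h\<in>carrier AutT. h \<otimes>\<^bsub>AutT\<^esub> g = \<one>\<^bsub>AutT\<^esub>"
    by (auto simp: AutT_def)
qed (auto simp: AutT_def tree_automorphism_def o_assoc intro: bij_comp)

lemma equiv_aut_equiv:
  assumes "group G"
  shows "equiv {H. subgroup H G} (aut_equiv G)"
proof (rule equivI)
  interpret group G by fact
  show "aut_equiv G \<subseteq> {H. subgroup H G} \<times> {H. subgroup H G}"
    by (auto simp: aut_equiv_def)
  show "refl_on {H. subgroup H G} (aut_equiv G)"
    by (auto simp: aut_equiv_def refl_on_def intro!: bexI[of _ "\<lambda>x. x"] iso_set_refl)
  show "sym (aut_equiv G)"
  proof (rule symI)
    fix H L assume "(H, L) \<in> aut_equiv G"
    then obtain \<phi> where *: "subgroup H G" "subgroup L G" "\<phi> \<in> iso G G" "\<phi> ` H = L"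
      by (auto simp: aut_equiv_def)
    have "inj_on \<phi> (carrier G)" "H \<subseteq> carrier G"
      using * by (auto simp: iso_def bij_betw_def subgroup.subset)
    then have "inv_into (carrier G) \<phi> ` L = H"
      using *(4) by (auto simp: inv_into_image_cancel)
    then show "(L, H) \<in> aut_equiv G"
      using * iso_set_sym[OF *(3)] by (auto simp: aut_equiv_def)
  qed
  show "trans (aut_equiv G)"
  proof (rule transI)
    fix H L M assume "(H, L) \<in> aut_equiv G" "(L, M) \<in> aut_equiv G"
    then obtain \<phi> \<chi> where "\<phi> \<in> iso G G" "\<phi> ` H = L" "\<chi> \<in> iso G G" "\<chi> ` L = M"
      and "subgroup H G" "subgroup M G"
      by (auto simp: aut_equiv_def)
    then show "(H, M) \<in> aut_equiv G"
      using iso_set_trans[of \<phi> G G \<chi> G]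
      by (auto simp: aut_equiv_def image_comp intro!: bexI[of _ "\<chi> \<circ> \<phi>"])
  qed
qed

lemma subgroup_boundary_stab:
  assumes "subgroup G AutT"
  shows "subgroup (boundary_stab G \<xi>) (grp G)"
proof -
  interpret A: group AutT by (rule group_AutT)
  interpret G: group "grp G"
    by (rule A.subgroup_imp_group[OF assms])
  have comp: "x \<otimes>\<^bsub>grp G\<^esub> y = x \<circ> y" and one: "\<one>\<^bsub>grp G\<^esub> = id" for x y
    by (simp_all add: AutT_def)
  show ?thesis
  proof (rule G.subgroupI)
    show "boundary_stab G \<xi> \<subseteq> carrier (grp G)"
      by (auto simp: boundary_stab_def)
    show "boundary_stab G \<xi> \<noteq> {}"
      using G.one_closed one by (auto simp: boundary_stab_def)
    fix a assume a: "a \<in> boundary_stab G \<xi>"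
    then have aG: "a \<in> carrier (grp G)" and ax: "a \<circ> \<xi> = \<xi>"
      by (auto simp: boundary_stab_def)
    let ?b = "inv\<^bsub>grp G\<^esub> a"
    have "?b \<circ> a = id"
      using G.l_inv[OF aG] comp one by metis
    then have "?b \<circ> \<xi> = \<xi>"
      using ax by (metis comp_assoc id_comp)
    then show "?b \<in> boundary_stab G \<xi>"
      using G.inv_closed[OF aG] by (simp add: boundary_stab_def)
    fix b assume b: "b \<in> boundary_stab G \<xi>"
    then have bG: "b \<in> carrier (grp G)" and bx: "b \<circ> \<xi> = \<xi>"
      by (auto simp: boundary_stab_def)
    show "a \<otimes>\<^bsub>grp G\<^esub> b \<in> boundary_stab G \<xi>"
      using G.m_closed[OF aG bG] ax bx unfolding comp
      by (simp add: boundary_stab_def comp_assoc)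
  qed
qed

end

theory Submission
  imports Defs
begin

text \<open>
  For a ray \<open>\<xi>\<close> let \<open>F\<close> be the finite orbit \<open>Q \<xi>\<close> and \<open>W\<close> its setwise stabilizer in \<open>G\<close>. Then \<open>W\<close> is
  weakly maximal: it contains the rigid stabilizer of every vertex off \<open>F\<close>, and since \<open>Q\<close> acts
  transitively on \<open>F\<close>, any further element \<open>h\<close> can be used to conjugate the rigid stabilizers of deep
  vertices on \<open>F\<close> into \<open>\<langle>W, h\<rangle>\<close>, which therefore contains the rigid stabilizer of a whole level and
  has finite index. The stabilizer \<open>W\<close> determines \<open>F\<close>, so there are uncountably many such \<open>W\<close>, whereas a
  finitely generated group has countable automorphism classes. Parabolic subgroups are excluded by a
  property invariant under automorphisms: an infinite-index subgroup that contains a finite-index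
  subgroup of the stabilizer of \<open>\<eta>\<close> is contained in that stabilizer. For \<open>W\<close> this fails, because its
  finite-index subgroup fixing \<open>F\<close> pointwise lies in the stabilizer of \<open>\<xi>\<close>, which is not contained
  in \<open>W\<close> when \<open>F\<close> has more than one element.
\<close>

section \<open>Groups of permutations and finite index\<close>

text \<open>Subgroups are described by composition and the function inverse alone, independently of
  any group record; \<open>subgroup_grp_iff\<close> translates back.\<close>

definition perm_group :: "('b \<Rightarrow> 'b) set \<Rightarrow> bool" where
  "perm_group H \<longleftrightarrow> id \<in> H \<and> (\<forall>g\<in>H. bij g \<and> inv' g \<in> H) \<and> (\<forall>g\<in>H. \<forall>h\<in>H. g \<circ> h \<in> H)"

text \<open>\<open>A\<close> is covered by finitely many right cosets of \<open>H\<close>; the set \<open>A\<close> need not contain \<open>H\<close>.\<close>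

definition virtually_contains :: "('b \<Rightarrow> 'b) set \<Rightarrow> ('b \<Rightarrow> 'b) set \<Rightarrow> bool" where
  "virtually_contains H A \<longleftrightarrow>
     (\<exists>f::('b \<Rightarrow> 'b) \<Rightarrow> nat. finite (f ` A) \<and> (\<forall>x\<in>A. \<forall>y\<in>A. f x = f y \<longrightarrow> x \<circ> inv' y \<in> H))"

lemma perm_groupD:
  assumes "perm_group H"
  shows "id \<in> H" "g \<in> H \<Longrightarrow> bij g" "g \<in> H \<Longrightarrow> inv' g \<in> H" "g \<in> H \<Longrightarrow> h \<in> H \<Longrightarrow> g \<circ> h \<in> H"
  using assms by (auto simp: perm_group_def)

text \<open>The definition can quantify over only one type of labels; a finite set of labels of
  another type is encoded by natural numbers.\<close>

lemma virtually_containsI: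
  assumes "finite (f ` A)" "\<And>x y. x \<in> A \<Longrightarrow> y \<in> A \<Longrightarrow> f x = f y \<Longrightarrow> x \<circ> inv' y \<in> H"
  shows "virtually_contains H A"
proof -
  have c: "countable (f ` A)" using assms(1) by (rule countable_finite)
  have "finite ((to_nat_on (f ` A) \<circ> f) ` A)"
    using assms(1) by (metis finite_imageI image_comp)
  moreover have "x \<circ> inv' y \<in> H"
    if "x \<in> A" "y \<in> A" "(to_nat_on (f ` A) \<circ> f) x = (to_nat_on (f ` A) \<circ> f) y" for x y
    using that assms(2) c by (simp add: to_nat_on_inj)
  ultimately show ?thesis unfolding virtually_contains_def by blast
qed

lemma virtually_containsE:
  assumes "virtually_contains H A"
  obtains f :: "('b \<Rightarrow> 'b) \<Rightarrow> nat"
  where "finite (f ` A)" "\<And>x y. x \<in> A \<Longrightarrow> y \<in> A \<Longrightarrow> f x = f y \<Longrightarrow> x \<circ> inv' y \<in> H"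
  using assms unfolding virtually_contains_def by blast

lemma virtually_contains_mono:
  assumes "virtually_contains H A" "B \<subseteq> A" "H \<subseteq> L"
  shows "virtually_contains L B"
proof -
  obtain f :: "('a \<Rightarrow> 'a) \<Rightarrow> nat" where f: "finite (f ` A)"
    "\<And>x y. x \<in> A \<Longrightarrow> y \<in> A \<Longrightarrow> f x = f y \<Longrightarrow> x \<circ> inv' y \<in> H"
    using virtually_containsE[OF assms(1)] by blast
  show ?thesis
  proof (rule virtually_containsI[of f])
    show "finite (f ` B)" using f(1) assms(2) by (meson finite_subset image_mono)
  qed (use f assms in auto)
qed

lemma virtually_contains_subset:
  assumes "perm_group H" "A \<subseteq> H"
  shows "virtually_contains H A"
  by (rule virtually_containsI[of "\<lambda>_. ()"]) (use assms in \<open>auto intro: perm_groupD\<close>)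

lemma comp_inv_cancel:
  assumes "bij y" "bij r"
  shows "(x \<circ> inv' r) \<circ> inv' (y \<circ> inv' r) = x \<circ> inv' y"
proof -
  have "inv' (y \<circ> inv' r) = r \<circ> inv' y"
    using assms by (simp add: o_inv_distrib bij_imp_bij_inv inv_inv_eq)
  then show ?thesis using assms(2)
    by (simp add: fun_eq_iff bij_is_inj)
qed

text \<open>An element of \<open>C\<close> is labelled by its class under \<open>g\<close> together
  with the \<open>f\<close>-label of its quotient by the representative of that class. Elements with
  equal labels share the representative, which then cancels.\<close>

lemma virtually_contains_trans:
  assumes "virtually_contains A B" "virtually_contains B C" "\<And>x. x \<in> C \<Longrightarrow> bij x"
  shows "virtually_contains A C"
proof -
  obtain f :: "('a \<Rightarrow> 'a) \<Rightarrow> nat" where f: "finite (f ` B)"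
    "\<And>x y. x \<in> B \<Longrightarrow> y \<in> B \<Longrightarrow> f x = f y \<Longrightarrow> x \<circ> inv' y \<in> A"
    using virtually_containsE[OF assms(1)] by blast
  obtain g :: "('a \<Rightarrow> 'a) \<Rightarrow> nat" where g: "finite (g ` C)"
    "\<And>x y. x \<in> C \<Longrightarrow> y \<in> C \<Longrightarrow> g x = g y \<Longrightarrow> x \<circ> inv' y \<in> B"
    using virtually_containsE[OF assms(2)] by blast
  define r where "r = inv_into C g"
  have r: "r (g x) \<in> C" "g (r (g x)) = g x" if "x \<in> C" for x
    using that unfolding r_def by (auto simp: inv_into_into f_inv_into_f)
  have B: "x \<circ> inv' (r (g x)) \<in> B" if "x \<in> C" for x
    using g(2) r that by metis
  show ?thesis
  proof (rule virtually_containsI[of "\<lambda>x. (g x, f (x \<circ> inv' (r (g x))))"])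
    show "finite ((\<lambda>x. (g x, f (x \<circ> inv' (r (g x))))) ` C)"
      by (rule finite_subset[of _ "g ` C \<times> f ` B"]) (use B f g in auto)
    fix x y assume xy: "x \<in> C" "y \<in> C"
      "(g x, f (x \<circ> inv' (r (g x)))) = (g y, f (y \<circ> inv' (r (g y))))"
    then have "g y = g x" "f (x \<circ> inv' (r (g x))) = f (y \<circ> inv' (r (g y)))" by auto
    then have "(x \<circ> inv' (r (g x))) \<circ> inv' (y \<circ> inv' (r (g x))) \<in> A"
      using f(2)[OF B[OF xy(1)] B[OF xy(2)]] by simp
    then show "x \<circ> inv' y \<in> A"
      using comp_inv_cancel[of y "r (g x)" x] assms(3) xy r by simp
  qed
qed

section \<open>Tree automorphisms\<close>

lemma AutT_simps [simp]:
  "carrier AutT = {g. tree_automorphism g}" "x \<otimes>\<^bsub>AutT\<^esub> y = x \<circ> y" "\<one>\<^bsub>AutT\<^esub> = id"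
  by (simp_all add: AutT_def)

lemma tree_automorphism_bij: "tree_automorphism g \<Longrightarrow> bij g"
  by (simp add: tree_automorphism_def)

lemma m_inv_AutT:
  assumes "tree_automorphism g"
  shows "inv\<^bsub>AutT\<^esub> g = inv' g"
proof -
  interpret group AutT by (rule group_AutT)
  have "inv\<^bsub>AutT\<^esub> g \<circ> g = id" "g \<circ> inv\<^bsub>AutT\<^esub> g = id"
    using l_inv[of g] r_inv[of g] assms by simp_all
  then show ?thesis by (metis inv_unique_comp)
qed

lemma subgroup_AutT_iff:
  "subgroup H AutT \<longleftrightarrow> H \<subseteq> Collect tree_automorphism \<and> perm_group H"
proof
  assume "subgroup H AutT"
  then interpret subgroup H AutT .
  have "H \<subseteq> Collect tree_automorphism" using subset by simp
  moreover have "inv' g \<in> H" if "g \<in> H" for g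
  proof -
    have "inv\<^bsub>AutT\<^esub> g = inv' g" using m_inv_AutT \<open>H \<subseteq> _\<close> that by blast
    then show ?thesis by (metis m_inv_closed that)
  qed
  ultimately show "H \<subseteq> Collect tree_automorphism \<and> perm_group H"
    using one_closed m_closed by (auto simp: perm_group_def intro: tree_automorphism_bij)
next
  interpret group AutT by (rule group_AutT)
  assume H: "H \<subseteq> Collect tree_automorphism \<and> perm_group H"
  have "inv\<^bsub>AutT\<^esub> g \<in> H" if "g \<in> H" for g
  proof -
    have "inv\<^bsub>AutT\<^esub> g = inv' g" using H that by (intro m_inv_AutT) blast
    then show ?thesis using perm_groupD(3)[of H g] H that by metis
  qed
  then show "subgroup H AutT"
    by (intro subgroupI) (use H in \<open>auto simp: perm_group_def\<close>)
qed

lemma subgroup_grp_iff: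
  assumes "subgroup G AutT"
  shows "subgroup H (grp G) \<longleftrightarrow> H \<subseteq> G \<and> perm_group H"
proof -
  interpret A: group AutT by (rule group_AutT)
  have "subgroup H (grp G) \<longleftrightarrow> subgroup H AutT \<and> H \<subseteq> G"
    using A.incl_subgroup[OF assms] A.subgroup_incl[OF _ assms] subgroup.subset[of H "grp G"]
    by auto
  then show ?thesis
    using assms unfolding subgroup_AutT_iff by blast
qed

lemma r_coset_AutT [simp]: "H #>\<^bsub>AutT\<^esub> x = (\<lambda>h. h \<circ> x) ` H"
  by (auto simp: r_coset_def)

text \<open>Two elements have the same right coset exactly when \<open>x \<circ> inv' y\<close> lies
  in \<open>H\<close>, so the cosets themselves serve as labels; conversely each class of a
  labelling stays within one coset.\<close>

lemma finite_rcosets_iff: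
  assumes G: "subgroup G AutT" and H: "subgroup H (grp G)"
  shows "finite (rcosets\<^bsub>grp G\<^esub> H) \<longleftrightarrow> virtually_contains H G"
proof -
  have bij: "bij x" if "x \<in> G" for x
    using that G by (auto simp: subgroup_AutT_iff perm_group_def)
  have HP: "perm_group H" "H \<subseteq> G" using H subgroup_grp_iff[OF G] by auto
  have rc: "rcosets\<^bsub>grp G\<^esub> H = (\<lambda>x. (\<lambda>h. h \<circ> x) ` H) ` G"
    by (auto simp: RCOSETS_def)
  show ?thesis
  proof
    assume fin: "finite (rcosets\<^bsub>grp G\<^esub> H)"
    show "virtually_contains H G"
    proof (rule virtually_containsI[of "\<lambda>x. (\<lambda>h. h \<circ> x) ` H"])
      show "finite ((\<lambda>x. (\<lambda>h. h \<circ> x) ` H) ` G)" using fin rc by simp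
      fix x y assume xy: "x \<in> G" "y \<in> G" "(\<lambda>h. h \<circ> x) ` H = (\<lambda>h. h \<circ> y) ` H"
      have "x \<in> (\<lambda>h. h \<circ> x) ` H"
        using perm_groupD(1)[OF HP(1)] by (metis id_comp image_eqI)
      then obtain h where "h \<in> H" "x = h \<circ> y" using xy by auto
      moreover have "h \<circ> y \<circ> inv' y = h" using bij[OF xy(2)]
        by (simp add: fun_eq_iff bij_is_surj surj_f_inv_f)
      ultimately show "x \<circ> inv' y \<in> H" by simp
    qed
  next
    assume "virtually_contains H G"
    then obtain f :: "_ \<Rightarrow> nat" where f: "finite (f ` G)"
      "\<And>x y. x \<in> G \<Longrightarrow> y \<in> G \<Longrightarrow> f x = f y \<Longrightarrow> x \<circ> inv' y \<in> H"
      using virtually_containsE by blast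
    have sub: "(\<lambda>h. h \<circ> x) ` H \<subseteq> (\<lambda>h. h \<circ> y) ` H" if "x \<in> G" "y \<in> G" "f x = f y" for x y
    proof safe
      fix h assume h: "h \<in> H"
      have "h \<circ> x = (h \<circ> (x \<circ> inv' y)) \<circ> y"
        using bij[OF that(2)] by (simp add: fun_eq_iff bij_is_inj)
      moreover have "h \<circ> (x \<circ> inv' y) \<in> H" using f(2)[OF that] h HP(1) perm_groupD(4) by blast
      ultimately show "h \<circ> x \<in> (\<lambda>h. h \<circ> y) ` H" by blast
    qed
    have eq: "(\<lambda>h. h \<circ> x) ` H = (\<lambda>h. h \<circ> inv_into G f (f x)) ` H" if "x \<in> G" for x
    proof -
      have "inv_into G f (f x) \<in> G" "f (inv_into G f (f x)) = f x"
        using that by (auto simp: inv_into_into f_inv_into_f)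
      then show ?thesis using sub that by (intro subset_antisym) simp_all
    qed
    have "rcosets\<^bsub>grp G\<^esub> H \<subseteq> (\<lambda>c. (\<lambda>h. h \<circ> inv_into G f c) ` H) ` f ` G"
      unfolding rc using eq by (auto simp del: o_apply)
    then show "finite (rcosets\<^bsub>grp G\<^esub> H)" by (rule finite_subset) (use f(1) in simp)
  qed
qed

text \<open>The image of a child of a non-root vertex is adjacent to the image of that vertex. It
  cannot be the parent there, since \<open>g\<close> already sends the original parent to it and is
  injective.\<close>

lemma tree_automorphism_snoc:
  assumes "tree_automorphism g"
  shows "\<exists>y. g (v @ [x]) = g v @ [y]"
proof (induction v arbitrary: x rule: rev_induct)
  case Nil
  have "tree_adj (g []) (g [x]) = tree_adj [] [x]" "g [] = []"
    using assms unfolding tree_automorphism_def by metis+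
  then show ?case by (auto simp: tree_adj_def)
next
  case (snoc z v)
  obtain y where y: "g (v @ [z]) = g v @ [y]" using snoc by blast
  have inj: "inj g" using assms by (simp add: tree_automorphism_def bij_is_inj)
  have "tree_adj (g (v @ [z])) (g ((v @ [z]) @ [x]))"
    using assms unfolding tree_automorphism_def tree_adj_def by blast
  moreover have "g (v @ [z]) \<noteq> g ((v @ [z]) @ [x]) @ [t]" for t
  proof
    assume "g (v @ [z]) = g ((v @ [z]) @ [x]) @ [t]"
    then have "g v = g ((v @ [z]) @ [x])" using y by simp
    then have "v = (v @ [z]) @ [x]" using inj by (simp add: inj_eq del: append_assoc)
    then show False by simp
  qed
  ultimately show ?case by (auto simp: tree_adj_def)
qed

lemma tree_automorphism_Nil [simp]: "tree_automorphism g \<Longrightarrow> g [] = []"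
  by (simp add: tree_automorphism_def)

lemma tree_automorphism_length:
  assumes "tree_automorphism g"
  shows "length (g v) = length v"
proof (induction v rule: rev_induct)
  case (snoc x v)
  then show ?case using tree_automorphism_snoc[OF assms, of v x] by auto
qed (use assms in simp)

lemma tree_automorphism_take:
  assumes "tree_automorphism g"
  shows "take n (g v) = g (take n v)"
proof (induction v rule: rev_induct)
  case (snoc x v)
  obtain y where y: "g (v @ [x]) = g v @ [y]" using tree_automorphism_snoc[OF assms] by blast
  show ?case
  proof (cases "n \<le> length v")
    case True
    then show ?thesis using y snoc tree_automorphism_length[OF assms, of v] by simp
  next
    case False
    then show ?thesis using tree_automorphism_length[OF assms, of "v @ [x]"] by simp
  qed
qed (use assms in simp)

section \<open>Rays\<close>

lemma boundary_length: "\<xi> \<in> boundary \<Longrightarrow> length (\<xi> n) = n"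
  by (induction n) (auto simp: boundary_def, metis length_append_singleton)

lemma boundary_take:
  assumes "\<xi> \<in> boundary" "m \<le> n"
  shows "take m (\<xi> n) = \<xi> m"
  using assms(2)
proof (induction n rule: dec_induct)
  case base
  then show ?case using boundary_length[OF assms(1)] by simp
next
  case (step n)
  obtain x where "\<xi> (Suc n) = \<xi> n @ [x]" using assms(1) by (auto simp: boundary_def)
  then show ?case using step boundary_length[OF assms(1), of n] by simp
qed

lemma eventually_boundary_neq:
  assumes "\<xi> \<in> boundary" "\<eta> \<in> boundary" "\<xi> \<noteq> \<eta>"
  shows "\<forall>\<^sub>F n in sequentially. \<xi> n \<noteq> \<eta> n"
proof -
  obtain m where "\<xi> m \<noteq> \<eta> m" using assms(3) by (auto simp: fun_eq_iff)
  then have "\<xi> n \<noteq> \<eta> n" if "n \<ge> m" for n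
    using boundary_take[OF assms(1) that] boundary_take[OF assms(2) that] by auto
  then show ?thesis by (auto simp: eventually_sequentially)
qed

lemma tree_automorphism_boundary:
  assumes "tree_automorphism g" "\<xi> \<in> boundary"
  shows "g \<circ> \<xi> \<in> boundary"
  unfolding boundary_def
proof (safe)
  show "(g \<circ> \<xi>) 0 = []" using assms by (simp add: boundary_def)
  fix n
  obtain x where "\<xi> (Suc n) = \<xi> n @ [x]" using assms(2) by (auto simp: boundary_def)
  then show "\<exists>x. (g \<circ> \<xi>) (Suc n) = (g \<circ> \<xi>) n @ [x]"
    using tree_automorphism_snoc[OF assms(1)] by simp
qed

lemma uncountable_boundary:
  assumes "card (UNIV :: 'a::finite set) \<ge> 2"
  shows "uncountable (boundary :: (nat \<Rightarrow> 'a list) set)"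
proof
  assume c: "countable (boundary :: (nat \<Rightarrow> 'a list) set)"
  obtain a b :: 'a where ab: "a \<noteq> b"
    using assms by (metis UNIV_I card_le_Suc0_iff_eq finite not_less_eq_eq numeral_2_eq_2)
  \<comment> \<open>A set of natural numbers is coded by its characteristic sequence in the two
    letters, so countability of the rays would contradict Cantor's theorem.\<close>
  define r where "r A n = map (\<lambda>i. if i \<in> A then a else b) [0..<n]" for A :: "nat set" and n
  have "r A \<in> boundary" for A by (auto simp: r_def boundary_def)
  moreover have "A = B" if "r A = r B" for A B
  proof -
    have "(i \<in> A) = (i \<in> B)" for i
    proof -
      have "r A (Suc i) ! i = r B (Suc i) ! i" using that by simp
      then show ?thesis using ab by (auto simp: r_def nth_append split: if_splits)
    qed
    then show ?thesis by blast
  qed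
  ultimately have "countable (range r)" "inj r"
    using countable_subset[OF _ c, of "range r"] by (auto simp: inj_def)
  then have "countable (UNIV :: nat set set)" by (rule countable_image_inj_on)
  then have "range (from_nat_into (UNIV :: nat set set)) = UNIV"
    by (intro range_from_nat_into) auto
  then show False using Cantors_theorem[of "UNIV :: nat set"] by (metis Pow_UNIV)
qed

section \<open>Countability of automorphism classes\<close>

lemma hom_eq_on_generate:
  assumes "group G" "f \<in> hom G G" "h \<in> hom G G" "S \<subseteq> carrier G" "\<And>x. x \<in> S \<Longrightarrow> f x = h x"
    and "x \<in> generate G S"
  shows "f x = h x"
proof -
  interpret f: group_hom G G f using assms by (simp add: group_hom_def group_hom_axioms_def)
  interpret h: group_hom G G h using assms by (simp add: group_hom_def group_hom_axioms_def)
  show ?thesis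
    using assms(6)
  proof (induction rule: generate.induct)
    case (inv x)
    then show ?case using assms(4,5) f.hom_inv h.hom_inv by (metis subsetD)
  next
    case (eng x y)
    then show ?case using f.generate_in_carrier[OF assms(4)] by simp
  qed (use assms in auto)
qed

lemma countable_generate:
  assumes "group G" "countable S" "S \<subseteq> carrier G"
  shows "countable (generate G S)"
proof -
  interpret group G by fact
  \<comment> \<open>The generated elements are the values \<open>m xs\<close> of words in
    \<open>S\<close> and its inverses.\<close>
  define m where "m xs = foldr (\<otimes>\<^bsub>G\<^esub>) xs \<one>\<^bsub>G\<^esub>" for xs
  define T where "T = S \<union> m_inv G ` S"
  have T: "T \<subseteq> carrier G" using assms(3) by (auto simp: T_def)
  have carr: "m xs \<in> carrier G" if "set xs \<subseteq> T" for xs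
    using that T by (induction xs) (auto simp: m_def)
  have app: "m (xs @ ys) = m xs \<otimes>\<^bsub>G\<^esub> m ys" if "set xs \<subseteq> T" "set ys \<subseteq> T" for xs ys
    using that
  proof (induction xs)
    case Nil
    then show ?case using carr by (simp add: m_def)
  next
    case (Cons x xs)
    then show ?case using carr[of xs] carr[of ys] T by (auto simp: m_def subset_iff intro!: m_assoc[symmetric])
  qed
  have "x \<in> m ` lists T" if "x \<in> generate G S" for x
    using that
  proof (induction rule: generate.induct)
    case one
    show ?case by (rule image_eqI[of _ _ "[]"]) (auto simp: m_def)
  next
    case (incl h)
    then show ?case using assms(3) by (intro image_eqI[of _ _ "[h]"]) (auto simp: m_def T_def)
  next
    case (inv h)
    then show ?case using assms(3)
      by (intro image_eqI[of _ _ "[m_inv G h]"]) (auto simp: m_def T_def)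
  next
    case (eng x y)
    then obtain xs ys where "x = m xs" "y = m ys" "set xs \<subseteq> T" "set ys \<subseteq> T"
      by (auto simp: in_lists_conv_set subset_iff)
    then show ?case using app by (intro image_eqI[of _ _ "xs @ ys"]) auto
  qed
  moreover have "countable (m ` lists T)"
    using assms(2) by (simp add: T_def)
  ultimately show ?thesis by (meson countable_subset subsetI)
qed

lemma countable_aut_class:
  assumes "group G" "finitely_generated G"
  shows "countable (aut_equiv G `` {H})"
proof -
  obtain S where S: "finite S" "S \<subseteq> carrier G" "generate G S = carrier G"
    using assms(2) by (auto simp: finitely_generated_def)
  obtain xs where xs: "set xs = S" using finite_list[OF S(1)] by blast
  have "countable (carrier G)"
    using countable_generate[OF assms(1) _ S(2)] S by (simp add: countable_finite)
  \<comment> \<open>An automorphism is determined by its values on the generators \<open>xs\<close>.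
    For the list of values of an actual automorphism the union has only one member, so
    \<open>T\<close> decodes that list to the image of \<open>H\<close>.\<close>
  define T where "T ys = \<Union>{\<phi> ` H |\<phi>. \<phi> \<in> iso G G \<and> map \<phi> xs = ys}" for ys
  have "L \<in> T ` lists (carrier G)" if HL: "(H, L) \<in> aut_equiv G" for L
  proof -
    obtain \<phi> where \<phi>: "\<phi> \<in> iso G G" "\<phi> ` H = L" and H: "subgroup H G"
      using HL by (auto simp: aut_equiv_def)
    have "\<chi> ` H = L" if "\<chi> \<in> iso G G" "map \<chi> xs = map \<phi> xs" for \<chi>
    proof -
      have "\<chi> x = \<phi> x" if "x \<in> H" for x
        by (rule hom_eq_on_generate[OF assms(1) _ _ S(2)])
          (use \<open>\<chi> \<in> iso G G\<close> \<open>map \<chi> xs = map \<phi> xs\<close> \<phi>(1) xs S(3) that subgroup.subset[OF H]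
            in \<open>simp_all add: iso_def subset_iff\<close>)
      then show ?thesis using \<phi>(2) by force
    qed
    then have "T (map \<phi> xs) = L" using \<phi> by (auto simp: T_def)
    moreover have "map \<phi> xs \<in> lists (carrier G)"
      using \<phi>(1) xs S(2) by (auto simp: iso_def hom_def Pi_iff subset_iff)
    ultimately show ?thesis by blast
  qed
  then show ?thesis
    using \<open>countable (carrier G)\<close> by (meson Image_singleton_iff countable_image
        countable_lists countable_subset subsetI)
qed

section \<open>Rigid stabilizers\<close>

text \<open>On the stabilizer of the first level this inverts \<open>psi1\<close>.\<close>

definition glue :: "('a \<Rightarrow> 'a list \<Rightarrow> 'a list) \<Rightarrow> 'a list \<Rightarrow> 'a list" where
  "glue k w = (case w of [] \<Rightarrow> [] | x # w \<Rightarrow> x # k x w)"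

text \<open>Of interest for \<open>U\<close> in level \<open>n\<close> and \<open>g\<close> fixing
  that level: the result is the factor of \<open>g\<close> on the subtrees at \<open>U\<close>, with
  words shorter than \<open>n\<close> left fixed.\<close>

definition res :: "nat \<Rightarrow> 'a list set \<Rightarrow> ('a list \<Rightarrow> 'a list) \<Rightarrow> 'a list \<Rightarrow> 'a list" where
  "res n U g w = (if take n w \<in> U then g w else w)"

definition rist :: "('a list \<Rightarrow> 'a list) set \<Rightarrow> 'a list \<Rightarrow> ('a list \<Rightarrow> 'a list) set" where
  "rist G u = {g \<in> G. \<forall>w. take (length u) w \<noteq> u \<longrightarrow> g w = w}"

text \<open>This is the direct product of one copy of \<open>K\<close> for each vertex of level
  \<open>n\<close>, acting on the subtree there.\<close>

primrec branch_level :: "('a list \<Rightarrow> 'a list) set \<Rightarrow> nat \<Rightarrow> ('a list \<Rightarrow> 'a list) set" where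
  "branch_level K 0 = K"
| "branch_level K (Suc n) = glue ` {k. \<forall>x. k x \<in> branch_level K n}"

lemma glue_simps [simp]: "glue k [] = []" "glue k (x # w) = x # k x w"
  by (simp_all add: glue_def)

lemma glue_comp: "glue k \<circ> glue l = glue (\<lambda>x. k x \<circ> l x)"
  by (auto simp: fun_eq_iff glue_def split: list.split)

lemma glue_id: "glue (\<lambda>_. id) = id"
  by (auto simp: fun_eq_iff glue_def split: list.split)

lemma glue_inv:
  assumes "\<And>x. bij (k x)"
  shows "bij (glue k)" "inv' (glue k) = glue (\<lambda>x. inv' (k x))"
proof -
  have "k x \<circ> inv' (k x) = id" "inv' (k x) \<circ> k x = id" for x
    using assms[of x] by (auto simp: fun_eq_iff bij_is_inj bij_is_surj surj_f_inv_f)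
  then have "glue k \<circ> glue (\<lambda>x. inv' (k x)) = id" "glue (\<lambda>x. inv' (k x)) \<circ> glue k = id"
    by (simp_all only: glue_comp glue_id)
  then show "bij (glue k)" "inv' (glue k) = glue (\<lambda>x. inv' (k x))"
    using inv_unique_comp by (blast intro: o_bij, blast)
qed

lemma branch_level_take:
  assumes "g \<in> branch_level K n"
  shows "take n (g w) = take n w"
  using assms
proof (induction n arbitrary: g w)
  case (Suc n)
  then show ?case by (cases w) auto
qed simp

lemma perm_group_branch_level:
  assumes "perm_group K"
  shows "perm_group (branch_level K n)"
proof (induction n)
  case (Suc n)
  note IH = perm_groupD[OF Suc]
  have "id \<in> branch_level K (Suc n)"
    unfolding branch_level.simps by (rule image_eqI[where x = "\<lambda>_. id"]) (simp_all add: glue_id IH(1))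
  then show ?case
    unfolding perm_group_def using IH by (auto simp: glue_comp glue_inv)
qed (use assms in simp)

text \<open>In a product of copies of \<open>K\<close>, factors may be replaced by the identity. The
  recursion passes to the subtree at \<open>x\<close>, where the relevant vertices are the words
  \<open>w\<close> with \<open>x # w\<close> in \<open>U\<close>.\<close>

lemma res_branch_level:
  assumes "perm_group K" "g \<in> branch_level K n"
  shows "res n U g \<in> branch_level K n"
  using assms(2)
proof (induction n arbitrary: g U)
  case 0
  then show ?case using perm_groupD(1)[OF assms(1)]
    by (cases "[] \<in> U") (auto simp: res_def id_def)
next
  case (Suc n)
  then obtain k where k: "g = glue k" "\<And>x. k x \<in> branch_level K n" by auto
  have "res (Suc n) U g = glue (\<lambda>x. res n {w. x # w \<in> U} (k x))"
    by (auto simp: fun_eq_iff res_def glue_def k split: list.split)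
  then show ?case using Suc.IH k(2) by auto
qed

lemma finite_level: "finite {u :: 'a::finite list. length u = n}"
  using finite_lists_length_eq[of "UNIV :: 'a set" n] by simp

section \<open>Branching data in terms of composition\<close>

locale branch_group =
  fixes G K :: "('a::finite list \<Rightarrow> 'a list) set"
  assumes card2: "card (UNIV :: 'a set) \<ge> 2"
    and subgroup_G: "subgroup G AutT"
    and transitive: "spherically_transitive G"
    and K_subset: "K \<subseteq> G"
    and perm_group_K: "perm_group K"
    and K_finite_index: "virtually_contains K G"
    and glue_K: "(\<And>x. k x \<in> K) \<Longrightarrow> glue k \<in> K"
    and glue_finite_index: "virtually_contains (glue ` {k. \<forall>x. k x \<in> K}) K"

text \<open>\<open>glue\<close> carries the two branching conditions from tuples back to
  \<open>K\<close>. The index is measured in all of \<open>K\<close>, where the first-level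
  stabilizer has finite index.\<close>

lemma regular_branch_imp_branch_group:
  assumes "card (UNIV :: 'a::finite set) \<ge> 2" "subgroup G AutT"
    and "regular_branch (G :: ('a list \<Rightarrow> 'a list) set)"
  shows "\<exists>K. branch_group G K"
proof -
  obtain K where K: "finite_index K (grp G)"
    "finite_index (UNIV \<rightarrow>\<^sub>E K) (AutT_pow\<lparr>carrier := psi1 ` (K \<inter> level_stab G 1)\<rparr>)"
    and tr: "spherically_transitive G"
    using assms(3) by (auto simp: regular_branch_def)
  have KG: "K \<subseteq> G" "perm_group K" "virtually_contains K G"
    using K(1) subgroup_grp_iff[OF assms(2)] finite_rcosets_iff[OF assms(2)]
    by (auto simp: finite_index_def)
  note KD = perm_groupD[OF KG(2)]
  have tree: "tree_automorphism g" if "g \<in> K" for g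
    using that KG(1) assms(2) by (auto simp: subgroup_AutT_iff)
  have decomp: "g (x # w) = x # psi1 g x w" if "g \<in> K \<inter> level_stab G 1" for g x w
  proof -
    have gx: "g [x] = [x]" "tree_automorphism g"
      using that tree by (auto simp: level_stab_def vertex_stab_def)
    have "take 1 (g (x # w)) = [x]"
      using tree_automorphism_take[OF gx(2), of 1 "x # w"] gx(1) by simp
    then show ?thesis by (cases "g (x # w)") (auto simp: psi1_def psi_def)
  qed
  \<comment> \<open>Elements of the level stabilizer are determined by their tuples of restrictions,
    so a relation between tuples lifts to one between automorphisms.\<close>
  have glueI: "g = glue k \<circ> h"
    if "g \<in> K \<inter> level_stab G 1" "h \<in> K \<inter> level_stab G 1" "\<And>x. psi1 g x = k x \<circ> psi1 h x" for g h k
  proof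
    fix w show "g w = (glue k \<circ> h) w"
      using that tree
      by (cases w) (auto simp: decomp[OF that(1)] decomp[OF that(2)] that(3) simp del: Int_iff)
  qed
  have id1: "id \<in> K \<inter> level_stab G 1"
    using KD(1) KG(1) by (auto simp: level_stab_def vertex_stab_def)
  have "glue k \<in> K" if k: "\<And>x. k x \<in> K" for k
  proof -
    have "k \<in> UNIV \<rightarrow>\<^sub>E K" using k by auto
    then have "k \<in> psi1 ` (K \<inter> level_stab G 1)"
      using K(2) subgroup.subset unfolding finite_index_def by fastforce
    then obtain g where g: "g \<in> K \<inter> level_stab G 1" "k = psi1 g" by blast
    have "psi1 g x = k x \<circ> psi1 id x" for x
      using g(2) by (auto simp: psi1_def psi_def)
    then have "g = glue k" using glueI[OF g(1) id1, of k] by simp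
    then show ?thesis using g by auto
  qed
  \<comment> \<open>Elements with the same action on the first level differ by an element of its
    stabilizer; vertices there are words of length one, so \<open>hd\<close> loses nothing.\<close>
  moreover have "virtually_contains (K \<inter> level_stab G 1) K"
  proof (rule virtually_containsI[of "\<lambda>g x. hd (g [x])"])
    fix g h assume gh: "g \<in> K" "h \<in> K" "(\<lambda>x. hd (g [x])) = (\<lambda>x. hd (h [x]))"
    have eq: "g [x] = h [x]" for x
    proof -
      have "length (g [x]) = 1" "length (h [x]) = 1"
        using gh tree tree_automorphism_length by fastforce+
      then show ?thesis using fun_cong[OF gh(3), of x]
        by (cases "g [x]"; cases "h [x]") auto
    qed
    have hi: "inv' h \<in> K" "bij h" using KD gh by auto
    have "(g \<circ> inv' h) v = v" if v: "length v = 1" for v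
    proof -
      have "length (inv' h v) = 1" using tree_automorphism_length[OF tree[OF hi(1)]] v by simp
      then obtain z where "inv' h v = [z]" by (auto simp: length_Suc_conv)
      then show ?thesis using eq[of z] hi(2) by (metis bij_inv_eq_iff comp_apply)
    qed
    then show "g \<circ> inv' h \<in> K \<inter> level_stab G 1"
      using KD gh hi KG(1) by (auto simp: level_stab_def vertex_stab_def)
  qed simp
  moreover have "virtually_contains (glue ` {k. \<forall>x. k x \<in> K}) (K \<inter> level_stab G 1)"
  proof -
    \<comment> \<open>The labels are right cosets of the product of copies of \<open>K\<close> in
      the image of \<open>psi1\<close>, finitely many by the branching hypothesis.\<close>
    define M where "M = AutT_pow\<lparr>carrier := psi1 ` (K \<inter> level_stab G 1)\<rparr>"
    define c where "c g = (UNIV \<rightarrow>\<^sub>E K) #>\<^bsub>M\<^esub> psi1 g" for g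
    have mult: "k \<otimes>\<^bsub>M\<^esub> l = (\<lambda>x. k x \<circ> l x)" for k l
      by (simp add: M_def AutT_pow_def restrict_def)
    have "finite (c ` (K \<inter> level_stab G 1))"
    proof (rule finite_subset)
      show "c ` (K \<inter> level_stab G 1) \<subseteq> rcosets\<^bsub>M\<^esub> (UNIV \<rightarrow>\<^sub>E K)"
        by (auto simp: c_def RCOSETS_def M_def)
      show "finite (rcosets\<^bsub>M\<^esub> (UNIV \<rightarrow>\<^sub>E K))"
        using K(2) by (simp add: M_def finite_index_def)
    qed
    then show ?thesis
    proof (rule virtually_containsI)
      fix g h assume gh: "g \<in> K \<inter> level_stab G 1" "h \<in> K \<inter> level_stab G 1" "c g = c h"
      have "psi1 g = (\<lambda>_. id) \<otimes>\<^bsub>M\<^esub> psi1 g" by (simp add: mult)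
      then have "psi1 g \<in> c g" unfolding c_def r_coset_def using KD(1) by auto
      then obtain k where k: "k \<in> UNIV \<rightarrow>\<^sub>E K" "psi1 g = k \<otimes>\<^bsub>M\<^esub> psi1 h"
        using gh(3) unfolding c_def r_coset_def by auto
      have "g = glue k \<circ> h" by (rule glueI[OF gh(1,2)]) (use k(2) in \<open>simp add: mult\<close>)
      moreover have "bij h" using gh KD by auto
      ultimately have "g \<circ> inv' h = glue k" by (simp add: fun_eq_iff bij_is_surj surj_f_inv_f)
      then show "g \<circ> inv' h \<in> glue ` {k. \<forall>x. k x \<in> K}" using k(1) by auto
    qed
  qed
  ultimately have "branch_group G K"
    using assms tr KG virtually_contains_trans KD(2)
    unfolding branch_group_def by blast
  then show ?thesis ..
qed

section \<open>Stabilizers of finite sets of rays\<close>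

definition pstab :: "('a list \<Rightarrow> 'a list) set \<Rightarrow> (nat \<Rightarrow> 'a list) set \<Rightarrow> ('a list \<Rightarrow> 'a list) set" where
  "pstab G F = {g \<in> G. \<forall>\<xi>\<in>F. g \<circ> \<xi> = \<xi>}"

definition sstab :: "('a list \<Rightarrow> 'a list) set \<Rightarrow> (nat \<Rightarrow> 'a list) set \<Rightarrow> ('a list \<Rightarrow> 'a list) set" where
  "sstab G F = {g \<in> G. (\<circ>) g ` F = F}"

lemma boundary_stab_eq_pstab: "boundary_stab G \<xi> = pstab G {\<xi>}"
  by (simp add: boundary_stab_def pstab_def)

lemma pstab_subset_sstab: "pstab G F \<subseteq> sstab G F"
  by (auto simp: pstab_def sstab_def image_iff)

context branch_group
begin

lemma perm_group_G: "perm_group G"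
  using subgroup_G by (simp add: subgroup_AutT_iff)

lemma tree_G: "g \<in> G \<Longrightarrow> tree_automorphism g"
  using subgroup_G by (auto simp: subgroup_AutT_iff)

lemmas G_closed = perm_groupD[OF perm_group_G]

lemma G_inv [simp]:
  assumes "g \<in> G"
  shows "g (inv' g w) = w" "inv' g (g w) = w" "g \<circ> inv' g = id" "inv' g \<circ> g = id"
    "g \<circ> (inv' g \<circ> \<xi>) = \<xi>" "inv' g \<circ> (g \<circ> \<xi>) = \<xi>"
  using G_closed(2)[OF assms]
  by (simp_all add: fun_eq_iff bij_is_inj bij_is_surj surj_f_inv_f)

section \<open>Product subgroups on the levels and their index\<close>

lemma branch_level_subset: "branch_level K n \<subseteq> K"
proof (induction n)
  case (Suc n)
  then show ?case using glue_K by (auto simp: subset_iff)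
qed simp

text \<open>Finite index in each of finitely many factors gives finite index in their product, so
  the induction step descends from \<open>G\<close> through \<open>K\<close> and the product of
  copies of \<open>K\<close> to the next level.\<close>

lemma virtually_contains_branch_level: "virtually_contains (branch_level K n) G"
proof (induction n)
  case 0
  show ?case using K_finite_index by simp
next
  case (Suc n)
  obtain f :: "_ \<Rightarrow> nat" where f: "finite (f ` G)"
    "\<And>x y. x \<in> G \<Longrightarrow> y \<in> G \<Longrightarrow> f x = f y \<Longrightarrow> x \<circ> inv' y \<in> branch_level K n"
    using virtually_containsE[OF Suc] by blast
  \<comment> \<open>This recovers the tuple from a glued automorphism, so that each component can be
    labelled.\<close>
  define sec where "sec g x w = tl (g (x # w))" for g :: "'a list \<Rightarrow> 'a list" and x w
  have sec_glue: "sec (glue k) = k" for k by (simp add: sec_def fun_eq_iff)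
  have "virtually_contains (branch_level K (Suc n)) (glue ` {k. \<forall>x. k x \<in> K})"
  proof (rule virtually_containsI[of "\<lambda>g x. f (sec g x)"])
    have "(\<lambda>g x. f (sec g x)) ` glue ` {k. \<forall>x. k x \<in> K} \<subseteq> UNIV \<rightarrow>\<^sub>E f ` G"
      using K_subset by (auto simp: sec_glue subset_iff intro!: imageI)
    moreover have "finite ((UNIV :: 'a set) \<rightarrow>\<^sub>E f ` G)" using f(1) by (intro finite_PiE) auto
    ultimately show "finite ((\<lambda>g x. f (sec g x)) ` glue ` {k. \<forall>x. k x \<in> K})"
      by (rule finite_subset)
    fix g h assume "g \<in> glue ` {k. \<forall>x. k x \<in> K}" "h \<in> glue ` {k. \<forall>x. k x \<in> K}"
      and eq: "(\<lambda>x. f (sec g x)) = (\<lambda>x. f (sec h x))"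
    then obtain k l where kl: "g = glue k" "h = glue l" "\<And>x. k x \<in> G" "\<And>x. l x \<in> G"
      using K_subset by blast
    have "f (k x) = f (l x)" for x using fun_cong[OF eq, of x] by (simp add: kl sec_glue)
    then have "k x \<circ> inv' (l x) \<in> branch_level K n" for x using f(2) kl by blast
    moreover have "g \<circ> inv' h = glue (\<lambda>x. k x \<circ> inv' (l x))"
      using kl G_closed(2) by (simp add: glue_inv glue_comp)
    ultimately show "g \<circ> inv' h \<in> branch_level K (Suc n)" by auto
  qed
  then show ?case
    using virtually_contains_trans glue_finite_index K_finite_index K_subset G_closed(2)
    by (metis (no_types, lifting) subset_iff)
qed

text \<open>The level-\<open>n\<close> part of the branching subgroup is a product of subgroups of the rigid
  stabilizers, so a group that meets each factor in finite index has finite index.\<close>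

lemma virtually_contains_rist:
  assumes H: "perm_group H"
    and rist: "\<And>u. length u = n \<Longrightarrow> virtually_contains H (rist G u)"
  shows "virtually_contains H G"
proof -
  let ?B = "branch_level K n"
  let ?L = "{u :: 'a list. length u = n}"
  have "\<forall>u\<in>?L. \<exists>f::_ \<Rightarrow> nat. finite (f ` rist G u) \<and>
      (\<forall>x\<in>rist G u. \<forall>y\<in>rist G u. f x = f y \<longrightarrow> x \<circ> inv' y \<in> H)"
    using rist unfolding virtually_contains_def by blast
  then obtain f :: "'a list \<Rightarrow> ('a list \<Rightarrow> 'a list) \<Rightarrow> nat" where
    f: "\<And>u. u \<in> ?L \<Longrightarrow> finite (f u ` rist G u)"
      "\<And>u x y. u \<in> ?L \<Longrightarrow> x \<in> rist G u \<Longrightarrow> y \<in> rist G u \<Longrightarrow> f u x = f u y \<Longrightarrow> x \<circ> inv' y \<in> H"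
    by (subst (asm) bchoice_iff) blast
  have resB: "res n U g \<in> G" if "g \<in> ?B" for U g
    using res_branch_level[OF perm_group_K that] branch_level_subset K_subset by blast
  have res_rist: "res n {u} g \<in> rist G u" if "g \<in> ?B" "u \<in> ?L" for u g
    using resB[OF that(1)] that(2) by (auto simp: rist_def res_def)
  \<comment> \<open>An element of the product is labelled by the tuple of labels of its
    factors.\<close>
  have "virtually_contains H ?B"
  proof (rule virtually_containsI[of "\<lambda>g. restrict (\<lambda>u. f u (res n {u} g)) ?L"])
    have "(\<lambda>g. restrict (\<lambda>u. f u (res n {u} g)) ?L) ` ?B \<subseteq> (\<Pi>\<^sub>E u\<in>?L. f u ` rist G u)"
      by (intro image_subsetI restrict_PiE_iff[THEN iffD2] ballI imageI) (rule res_rist)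
    moreover have "finite (\<Pi>\<^sub>E u\<in>?L. f u ` rist G u)"
      using f(1) finite_level by (intro finite_PiE) auto
    ultimately show "finite ((\<lambda>g. restrict (\<lambda>u. f u (res n {u} g)) ?L) ` ?B)"
      by (rule finite_subset)
    fix g h assume g: "g \<in> ?B" and h: "h \<in> ?B"
      and eq: "restrict (\<lambda>u. f u (res n {u} g)) ?L = restrict (\<lambda>u. f u (res n {u} h)) ?L"
    define p where "p = g \<circ> inv' h"
    have hG: "h \<in> G" using h branch_level_subset K_subset by blast
    have ph: "p \<circ> h = g" using hG by (simp add: p_def fun_eq_iff)
    have pB: "p \<in> ?B"
      using perm_groupD[OF perm_group_branch_level[OF perm_group_K]] g h p_def by blast
    have res_comp: "res n U p \<circ> res n U h = res n U g" for U
      using branch_level_take[OF h] by (auto simp: fun_eq_iff res_def ph[symmetric])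
    \<comment> \<open>Equal labels put each single factor of \<open>p\<close> into \<open>H\<close>;
      the factors are then multiplied together vertex by vertex.\<close>
    have one: "res n {u} p \<in> H" if u: "u \<in> ?L" for u
    proof -
      have "f u (res n {u} g) = f u (res n {u} h)" using fun_cong[OF eq, of u] u by simp
      then have "res n {u} g \<circ> inv' (res n {u} h) \<in> H" using f(2) res_rist g h u by blast
      moreover have "res n {u} g \<circ> inv' (res n {u} h) = res n {u} p"
        using resB[OF h] by (simp add: res_comp[symmetric] comp_assoc)
      ultimately show ?thesis by simp
    qed
    have "res n U p \<in> H" if "finite U" "U \<subseteq> ?L" for U
      using that
    proof (induction U rule: finite_induct)
      case empty
      have "res n {} p = id" by (simp add: res_def fun_eq_iff)
      then show ?case using perm_groupD(1)[OF H] by (simp only:)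
    next
      case (insert u U)
      have "res n (insert u U) p = res n {u} p \<circ> res n U p"
        using insert.hyps branch_level_take[OF pB] by (auto simp: fun_eq_iff res_def)
      then show ?case using perm_groupD(4)[OF H one insert.IH] insert.prems
        by (simp only: insert_subset)
    qed
    then have "res n ?L p \<in> H" using finite_level by blast
    \<comment> \<open>Words shorter than \<open>n\<close> are left alone by \<open>res\<close>;
      \<open>p\<close> fixes them too, because it preserves lengths and prefixes of length
      \<open>n\<close>.\<close>
    moreover have "res n ?L p = p"
    proof
      fix w
      show "res n ?L p w = p w"
      proof (cases "length w \<ge> n")
        case False
        then show ?thesis using branch_level_take[OF pB, of w]
            tree_automorphism_length[OF tree_G, of p w] pB branch_level_subset K_subset
          by (auto simp: res_def subset_iff)
      qed (simp add: res_def)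
    qed
    ultimately show "g \<circ> inv' h \<in> H" by (simp only: p_def)
  qed
  then show ?thesis
    using virtually_contains_trans virtually_contains_branch_level G_closed(2) by blast
qed

section \<open>Stabilizers of rays and their index\<close>

lemma perm_group_pstab: "perm_group (pstab G F)"
  unfolding perm_group_def
proof (intro conjI ballI)
  fix g assume g: "g \<in> pstab G F"
  then have gG: "g \<in> G" by (simp add: pstab_def)
  show "bij g" using gG G_closed by blast
  have "inv' g \<circ> \<xi> = \<xi>" if "\<xi> \<in> F" for \<xi>
    using G_inv(6)[OF gG, of \<xi>] g that by (simp add: pstab_def)
  then show "inv' g \<in> pstab G F" using G_closed gG by (simp add: pstab_def)
  fix h assume "h \<in> pstab G F"
  then show "g \<circ> h \<in> pstab G F" using g G_closed by (simp add: pstab_def comp_assoc)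
qed (use G_closed in \<open>simp add: pstab_def\<close>)

lemma perm_group_sstab: "perm_group (sstab G F)"
  unfolding perm_group_def
proof (intro conjI ballI)
  fix g assume g: "g \<in> sstab G F"
  then have gG: "g \<in> G" and gF: "(\<circ>) g ` F = F" by (simp_all add: sstab_def)
  show "bij g" using gG G_closed by blast
  have "(\<circ>) (inv' g) ` (\<circ>) g ` F = F" using gG by (simp add: image_image)
  then show "inv' g \<in> sstab G F" using G_closed gG gF by (simp add: sstab_def)
  fix h assume h: "h \<in> sstab G F"
  have "(\<circ>) (g \<circ> h) ` F = (\<circ>) g ` (\<circ>) h ` F" by (simp add: image_image comp_assoc)
  then show "g \<circ> h \<in> sstab G F" using g h G_closed by (simp add: sstab_def)
qed (use G_closed in \<open>simp add: sstab_def\<close>)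

text \<open>The pointwise stabilizer is the kernel of the action on a finite set; the induced map on
  \<open>F\<close> is the label.\<close>

lemma pstab_virtually_contains_sstab:
  assumes "finite F"
  shows "virtually_contains (pstab G F) (sstab G F)"
proof (rule virtually_containsI[of "\<lambda>g. restrict ((\<circ>) g) F"])
  have "(\<lambda>g. restrict ((\<circ>) g) F) ` sstab G F \<subseteq> F \<rightarrow>\<^sub>E F" by (auto simp: sstab_def)
  then show "finite ((\<lambda>g. restrict ((\<circ>) g) F) ` sstab G F)"
    using assms by (meson finite_PiE finite_subset)
  fix g h assume gh: "g \<in> sstab G F" "h \<in> sstab G F" "restrict ((\<circ>) g) F = restrict ((\<circ>) h) F"
  then have G: "g \<in> G" "h \<in> G" by (simp_all add: sstab_def)
  have "(g \<circ> inv' h) \<circ> \<xi> = \<xi>" if "\<xi> \<in> F" for \<xi>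
  proof -
    have "\<xi> \<in> (\<circ>) h ` F" using gh(2) that by (simp add: sstab_def)
    then obtain \<zeta> where z: "\<zeta> \<in> F" "\<xi> = h \<circ> \<zeta>" by blast
    have "g \<circ> \<zeta> = h \<circ> \<zeta>" using fun_cong[OF gh(3), of \<zeta>] z(1) by simp
    then show ?thesis using z G by (simp add: comp_assoc)
  qed
  then show "g \<circ> inv' h \<in> pstab G F" using G G_closed by (simp add: pstab_def)
qed

text \<open>With finite index, the orbit of \<open>\<xi> n\<close> has at most as many elements as
  there are labels. By transitivity it is the whole level, of size at least \<open>2 ^ n\<close>,
  which is too large once \<open>n\<close> is taken to be the number of labels.\<close>

lemma not_virtually_contains_pstab:
  assumes "\<xi> \<in> boundary"
  shows "\<not> virtually_contains (pstab G {\<xi>}) G"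
proof
  assume "virtually_contains (pstab G {\<xi>}) G"
  then obtain f :: "_ \<Rightarrow> nat" where f: "finite (f ` G)"
    "\<And>x y. x \<in> G \<Longrightarrow> y \<in> G \<Longrightarrow> f x = f y \<Longrightarrow> x \<circ> inv' y \<in> pstab G {\<xi>}"
    using virtually_containsE by blast
  define n where "n = card (f ` G)"
  have "v \<in> (\<lambda>c. inv' (inv_into G f c) (\<xi> n)) ` f ` G" if v: "length v = n" for v
  proof -
    obtain g where g: "g \<in> G" "g (\<xi> n) = v"
      using transitive v boundary_length[OF assms] unfolding spherically_transitive_def by blast
    \<comment> \<open>The labels control right cosets, so the vertex that depends only on the label
      of \<open>x\<close> is \<open>inv' x (\<xi> n)\<close>; hence \<open>v\<close> is reached
      through the label of \<open>inv' g\<close>.\<close>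
    define r where "r = inv_into G f (f (inv' g))"
    have ig: "inv' g \<in> G" using g G_closed by blast
    then have r: "r \<in> G" "f r = f (inv' g)"
      by (auto simp: r_def inv_into_into f_inv_into_f)
    have "r \<circ> inv' (inv' g) \<in> pstab G {\<xi>}" using f(2) r ig by blast
    then have "r \<circ> g \<in> pstab G {\<xi>}" using G_closed(2)[OF g(1)] by (simp add: inv_inv_eq)
    then have "r (g (\<xi> n)) = \<xi> n" by (auto simp: pstab_def fun_eq_iff)
    then have "v = inv' r (\<xi> n)" using g r G_inv(2)[OF r(1)] by metis
    then show ?thesis using ig by (auto simp: r_def)
  qed
  then have "{v :: 'a list. length v = n} \<subseteq> (\<lambda>c. inv' (inv_into G f c) (\<xi> n)) ` f ` G" by blast
  then have "card {v :: 'a list. length v = n} \<le> n"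
    unfolding n_def by (rule surj_card_le[OF f(1)])
  moreover have "card {v :: 'a list. length v = n} = card (UNIV :: 'a set) ^ n"
    using card_lists_length_eq[of "UNIV :: 'a set" n] by simp
  moreover have "2 ^ n \<le> card (UNIV :: 'a set) ^ n" using card2 by (rule power_mono) simp
  ultimately show False using less_exp[of n] by simp
qed

section \<open>Rigid stabilizers against rays\<close>

lemma rist_fixes:
  assumes "g \<in> rist G u"
  shows "g u = u"
proof (rule ccontr)
  assume "g u \<noteq> u"
  have gG: "g \<in> G" using assms by (simp add: rist_def)
  have "length (g u) = length u" using tree_automorphism_length[OF tree_G[OF gG]] .
  \<comment> \<open>Having the same length as \<open>u\<close> but differing from it,
    \<open>g u\<close> lies outside the subtree at \<open>u\<close>.\<close>
  then have "g (g u) = g u" using assms \<open>g u \<noteq> u\<close> by (simp add: rist_def)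
  then show False using \<open>g u \<noteq> u\<close> G_inv(2)[OF gG] by metis
qed

lemma rist_subset_pstab:
  assumes "F \<subseteq> boundary" "u \<notin> (\<lambda>\<eta>. \<eta> (length u)) ` F"
  shows "rist G u \<subseteq> pstab G F"
proof
  fix g assume g: "g \<in> rist G u"
  have "g (\<eta> m) = \<eta> m" if "\<eta> \<in> F" for \<eta> m
  proof -
    have \<eta>: "\<eta> \<in> boundary" "u \<noteq> \<eta> (length u)" using assms that by auto
    have "take (length u) (\<eta> m) \<noteq> u"
    proof (cases "length u \<le> m")
      case True
      then show ?thesis using boundary_take[OF \<eta>(1) True] \<eta>(2) by auto
    next
      case False
      then show ?thesis using boundary_length[OF \<eta>(1), of m] by auto
    qed
    then show ?thesis using g by (simp add: rist_def)
  qed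
  then show "g \<in> pstab G F" using g by (auto simp: pstab_def rist_def)
qed

text \<open>Otherwise the rigid stabilizers of all vertices of level \<open>n\<close> would fix
  \<open>\<eta>\<close>, those off the ray doing so anyway, and
  \<open>virtually_contains_rist\<close> would give the stabilizer of \<open>\<eta>\<close> finite
  index.\<close>

lemma rist_moves:
  assumes "\<eta> \<in> boundary"
  shows "\<exists>g\<in>rist G (\<eta> n). g \<circ> \<eta> \<noteq> \<eta>"
proof (rule ccontr)
  assume *: "\<not> (\<exists>g\<in>rist G (\<eta> n). g \<circ> \<eta> \<noteq> \<eta>)"
  have "virtually_contains (pstab G {\<eta>}) (rist G u)" if "length u = n" for u
  proof (rule virtually_contains_subset[OF perm_group_pstab])
    show "rist G u \<subseteq> pstab G {\<eta>}"
    proof (cases "u = \<eta> n")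
      case True
      then show ?thesis using * by (auto simp: pstab_def rist_def)
    qed (use rist_subset_pstab[of "{\<eta>}" u] assms that in auto)
  qed
  then show False
    using virtually_contains_rist[OF perm_group_pstab] not_virtually_contains_pstab[OF assms]
    by blast
qed

text \<open>If \<open>h \<zeta> \<notin> F\<close>, conjugation by \<open>h\<close> carries the rigid stabilizer of a deep vertex on \<open>\<zeta>\<close> to
  one that fixes \<open>F\<close> pointwise.\<close>

lemma virtually_contains_if_moves:
  assumes F: "finite F" "F \<subseteq> boundary"
    and H: "perm_group H" "H \<subseteq> G" "virtually_contains H (pstab G F)"
    and moves: "\<And>\<zeta>. \<zeta> \<in> F \<Longrightarrow> \<exists>h\<in>H. h \<circ> \<zeta> \<notin> F"
  shows "virtually_contains H G"
proof -
  obtain h where h: "\<And>\<zeta>. \<zeta> \<in> F \<Longrightarrow> h \<zeta> \<in> H" "\<And>\<zeta>. \<zeta> \<in> F \<Longrightarrow> h \<zeta> \<circ> \<zeta> \<notin> F"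
    using moves by metis
  \<comment> \<open>Finitely many pairs of distinct rays are separated at all sufficiently deep
    levels, so one depth \<open>n\<close> works for every \<open>\<zeta>\<close> with its own
    \<open>h \<zeta>\<close>.\<close>
  have "\<forall>\<^sub>F n in sequentially. \<forall>\<zeta>\<in>F. \<forall>\<eta>\<in>F. (h \<zeta> \<circ> \<zeta>) n \<noteq> \<eta> n"
  proof (intro eventually_ball_finite[OF F(1)] ballI eventually_boundary_neq)
    fix \<zeta> \<eta> assume "\<zeta> \<in> F" "\<eta> \<in> F"
    then show "h \<zeta> \<circ> \<zeta> \<in> boundary" "\<eta> \<in> boundary" "h \<zeta> \<circ> \<zeta> \<noteq> \<eta>"
      using F H(2) h tree_automorphism_boundary[OF tree_G] by (blast, blast, metis)
  qed
  then obtain n where n: "\<And>\<zeta> \<eta>. \<zeta> \<in> F \<Longrightarrow> \<eta> \<in> F \<Longrightarrow> h \<zeta> (\<zeta> n) \<noteq> \<eta> n"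
    by (auto simp: eventually_sequentially)
  have free: "virtually_contains H (rist G u)"
    if "length u = n" "u \<notin> (\<lambda>\<eta>. \<eta> n) ` F" for u
    by (rule virtually_contains_mono[OF H(3)]) (use rist_subset_pstab[OF F(2), of u] that in auto)
  have "virtually_contains H (rist G u)" if u: "length u = n" for u
  proof (cases "u \<in> (\<lambda>\<eta>. \<eta> n) ` F")
    case True
    then obtain \<zeta> where z: "\<zeta> \<in> F" "u = \<zeta> n" by blast
    define k where "k = h \<zeta>"
    have k: "k \<in> H" "k \<in> G" using h z H(2) by (auto simp: k_def)
    have ik: "inv' k \<in> H" "inv' k \<in> G" using k perm_groupD(3)[OF H(1)] H(2) by auto
    have ku: "length (k u) = n" using tree_automorphism_length[OF tree_G[OF k(2)]] u by simp
    have "virtually_contains H (rist G (k u))"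
      by (rule free[OF ku]) (use n z in \<open>auto simp: k_def\<close>)
    then obtain f :: "_ \<Rightarrow> nat" where f: "finite (f ` rist G (k u))"
      "\<And>x y. x \<in> rist G (k u) \<Longrightarrow> y \<in> rist G (k u) \<Longrightarrow> f x = f y \<Longrightarrow> x \<circ> inv' y \<in> H"
      using virtually_containsE by blast
    have conj: "k \<circ> g \<circ> inv' k \<in> rist G (k u)" if g: "g \<in> rist G u" for g
    proof -
      have gG: "g \<in> G" using g by (simp add: rist_def)
      have "g (inv' k w) = inv' k w" if "take n w \<noteq> k u" for w
      proof -
        have "take n (inv' k w) = inv' k (take n w)"
          by (rule tree_automorphism_take[OF tree_G[OF ik(2)]])
        then have "take n (inv' k w) \<noteq> u" using that k by (metis G_inv(1))
        then show ?thesis using g u by (simp add: rist_def)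
      qed
      then show ?thesis using gG k ik ku G_closed(4) by (simp add: rist_def)
    qed
    show ?thesis
    proof (rule virtually_containsI[of "\<lambda>g. f (k \<circ> g \<circ> inv' k)"])
      have "(\<lambda>g. f (k \<circ> g \<circ> inv' k)) ` rist G u \<subseteq> f ` rist G (k u)" using conj by blast
      then show "finite ((\<lambda>g. f (k \<circ> g \<circ> inv' k)) ` rist G u)" using f(1) by (rule finite_subset)
      fix x y assume xy: "x \<in> rist G u" "y \<in> rist G u"
        "f (k \<circ> x \<circ> inv' k) = f (k \<circ> y \<circ> inv' k)"
      \<comment> \<open>\<open>z\<close> equals
        \<open>k \<circ> x \<circ> inv' y \<circ> inv' k\<close>; since \<open>k\<close> lies in
        \<open>H\<close>, conjugating back stays in \<open>H\<close>.\<close>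
      define z where "z = (k \<circ> x \<circ> inv' k) \<circ> inv' (k \<circ> y \<circ> inv' k)"
      have zH: "z \<in> H" unfolding z_def using f(2)[OF conj conj] xy by blast
      have yG: "y \<in> G" "k \<circ> y \<circ> inv' k \<in> G"
        using xy(2) conj[OF xy(2)] by (simp_all add: rist_def)
      have "z \<circ> (k \<circ> y \<circ> inv' k) = k \<circ> x \<circ> inv' k"
        unfolding z_def using G_inv(4)[OF yG(2)] by (simp only: comp_assoc comp_id)
      then have "inv' k (z (k (y (inv' k (k (inv' y w)))))) = inv' k (k (x (inv' k (k (inv' y w)))))" for w
        by (simp add: fun_eq_iff)
      then have "inv' k \<circ> z \<circ> k = x \<circ> inv' y" using k yG(1) by (simp add: fun_eq_iff)
      moreover have "inv' k \<circ> z \<circ> k \<in> H" using perm_groupD(4)[OF H(1)] ik(1) zH k(1) by blast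
      ultimately show "x \<circ> inv' y \<in> H" by simp
    qed
  qed (use free u in blast)
  then show ?thesis by (rule virtually_contains_rist[OF H(1)])
qed

text \<open>For a ray \<open>\<eta>\<close> in \<open>F\<close> outside \<open>E\<close>, choose a
  vertex on it off \<open>E\<close> and off the other rays of \<open>F\<close>. Its rigid stabilizer
  fixes \<open>E\<close> pointwise but contains an element moving \<open>\<eta>\<close> to another
  ray through the same vertex, which therefore lies outside \<open>F\<close>.\<close>

lemma pstab_subset_sstab_imp_subset:
  assumes "finite E" "E \<subseteq> boundary" "finite F" "F \<subseteq> boundary" "pstab G E \<subseteq> sstab G F"
  shows "F \<subseteq> E"
proof (rule ccontr)
  assume "\<not> F \<subseteq> E"
  then obtain \<eta> where \<eta>: "\<eta> \<in> F" "\<eta> \<notin> E" by blast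
  have "\<forall>\<^sub>F n in sequentially. \<forall>\<zeta>\<in>E \<union> (F - {\<eta>}). \<eta> n \<noteq> \<zeta> n"
    by (intro eventually_ball_finite ballI eventually_boundary_neq) (use assms \<eta> in auto)
  then obtain n where n: "\<And>\<zeta>. \<zeta> \<in> E \<union> (F - {\<eta>}) \<Longrightarrow> \<eta> n \<noteq> \<zeta> n"
    by (auto simp: eventually_sequentially)
  have \<eta>b: "\<eta> \<in> boundary" using \<eta> assms by blast
  obtain g where g: "g \<in> rist G (\<eta> n)" "g \<circ> \<eta> \<noteq> \<eta>" using rist_moves[OF \<eta>b] by blast
  have "g \<in> pstab G E"
    using rist_subset_pstab[OF assms(2), of "\<eta> n"] g(1) n boundary_length[OF \<eta>b, of n] by auto
  then have "g \<circ> \<eta> \<in> F" using assms(5) \<eta>(1) by (auto simp: sstab_def)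
  moreover have "(g \<circ> \<eta>) n = \<eta> n" using rist_fixes[OF g(1)] by simp
  ultimately show False using n g(2) by (metis DiffI UnI2 singletonD)
qed

section \<open>Weak maximality of setwise stabilizers\<close>

lemma infinite_index_iff:
  "infinite_index H (grp G) \<longleftrightarrow> H \<subseteq> G \<and> perm_group H \<and> \<not> virtually_contains H G"
  using subgroup_grp_iff[OF subgroup_G] finite_rcosets_iff[OF subgroup_G]
  unfolding infinite_index_def by blast

text \<open>An additional element moves at least one ray out of \<open>F\<close>; by
  \<open>trans\<close>, its composites with the stabilizer move every ray of \<open>F\<close> out,
  as \<open>virtually_contains_if_moves\<close> demands.\<close>

lemma weakly_maximal_sstab:
  assumes F: "finite F" "F \<subseteq> boundary" "F \<noteq> {}"
    and trans: "\<And>\<zeta> \<eta>. \<zeta> \<in> F \<Longrightarrow> \<eta> \<in> F \<Longrightarrow> \<exists>q\<in>sstab G F. q \<circ> \<zeta> = \<eta>"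
  shows "weakly_maximal (sstab G F) (grp G)"
  unfolding weakly_maximal_def
proof (intro conjI allI impI)
  obtain \<xi> where \<xi>: "\<xi> \<in> F" using F(3) by blast
  show "infinite_index (sstab G F) (grp G)"
    unfolding infinite_index_iff
  proof (intro conjI notI)
    assume "virtually_contains (sstab G F) G"
    then have "virtually_contains (pstab G F) G"
      using virtually_contains_trans pstab_virtually_contains_sstab[OF F(1)] G_closed(2) by blast
    then have "virtually_contains (pstab G {\<xi>}) G"
      by (rule virtually_contains_mono) (use \<xi> in \<open>auto simp: pstab_def\<close>)
    then show False using not_virtually_contains_pstab F(2) \<xi> by blast
  qed (auto simp: sstab_def perm_group_sstab[unfolded sstab_def])
  fix L assume "infinite_index L (grp G) \<and> sstab G F \<subseteq> L"
  then have L: "L \<subseteq> G" "perm_group L" "\<not> virtually_contains L G" "sstab G F \<subseteq> L"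
    by (auto simp: infinite_index_iff)
  have "h \<in> sstab G F" if hL: "h \<in> L" for h
  proof (rule ccontr)
    assume "h \<notin> sstab G F"
    have hG: "h \<in> G" using L hL by blast
    \<comment> \<open>An injective map of the finite set \<open>F\<close> into itself is onto, so
      failing to preserve \<open>F\<close> means that some ray leaves it.\<close>
    have "inj ((\<circ>) h :: (nat \<Rightarrow> 'a list) \<Rightarrow> _)" using G_inv(6)[OF hG] by (metis injI)
    then have "\<not> (\<circ>) h ` F \<subseteq> F"
      using \<open>h \<notin> sstab G F\<close> hG F(1) endo_inj_surj[of F "(\<circ>) h"]
      by (auto simp: sstab_def intro: inj_on_subset)
    then obtain \<eta> where \<eta>: "\<eta> \<in> F" "h \<circ> \<eta> \<notin> F" by blast
    have "\<exists>k\<in>L. k \<circ> \<zeta> \<notin> F" if "\<zeta> \<in> F" for \<zeta>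
    proof -
      obtain q where q: "q \<in> sstab G F" "q \<circ> \<zeta> = \<eta>" using trans \<open>\<zeta> \<in> F\<close> \<eta>(1) by blast
      then have "h \<circ> q \<in> L" "(h \<circ> q) \<circ> \<zeta> \<notin> F"
        using L(4) perm_groupD(4)[OF L(2) hL, of q] \<eta>(2) by (auto simp: comp_assoc)
      then show ?thesis by blast
    qed
    moreover have "virtually_contains L (pstab G F)"
      using virtually_contains_subset L pstab_subset_sstab by (metis subset_trans)
    ultimately show False using virtually_contains_if_moves F L by blast
  qed
  then show "L = sstab G F" using L(4) by blast
qed

section \<open>Transport along automorphisms of the group\<close>

lemma iso_facts:
  assumes "\<phi> \<in> iso (grp G) (grp G)"
  shows "x \<in> G \<Longrightarrow> y \<in> G \<Longrightarrow> \<phi> (x \<circ> y) = \<phi> x \<circ> \<phi> y" "x \<in> G \<Longrightarrow> \<phi> x \<in> G"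
    "inj_on \<phi> G" "\<phi> ` G = G" "\<phi> id = id" "x \<in> G \<Longrightarrow> \<phi> (inv' x) = inv' (\<phi> x)"
proof -
  have mult: "\<phi> (x \<circ> y) = \<phi> x \<circ> \<phi> y" if "x \<in> G" "y \<in> G" for x y
    using assms that by (auto simp: iso_def hom_def)
  have closed: "\<phi> x \<in> G" if "x \<in> G" for x
    using assms that by (auto simp: iso_def hom_def)
  have "\<phi> id \<circ> \<phi> id = \<phi> id" using mult[of id id] G_closed(1) by simp
  then have id: "\<phi> id = id"
    using G_inv(6)[OF closed, of id "\<phi> id"] G_inv(4)[OF closed, of id] G_closed(1) by simp
  show "x \<in> G \<Longrightarrow> y \<in> G \<Longrightarrow> \<phi> (x \<circ> y) = \<phi> x \<circ> \<phi> y" "x \<in> G \<Longrightarrow> \<phi> x \<in> G" "\<phi> id = id"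
    using mult closed id by auto
  show "inj_on \<phi> G" "\<phi> ` G = G" using assms by (auto simp: iso_def bij_betw_def)
  assume x: "x \<in> G"
  then have "\<phi> x \<circ> \<phi> (inv' x) = id" "\<phi> (inv' x) \<circ> \<phi> x = id"
    using mult[of x "inv' x"] mult[of "inv' x" x] G_closed(3)[OF x] id by simp_all
  then show "\<phi> (inv' x) = inv' (\<phi> x)" by (metis inv_unique_comp)
qed

lemma perm_group_iso_image:
  assumes "\<phi> \<in> iso (grp G) (grp G)" "perm_group H" "H \<subseteq> G"
  shows "perm_group (\<phi> ` H)"
  unfolding perm_group_def
proof (intro conjI ballI)
  note \<phi> = iso_facts[OF assms(1)] and H = perm_groupD[OF assms(2)]
  show "id \<in> \<phi> ` H" using \<phi>(5) H(1) by (metis imageI)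
  fix a assume "a \<in> \<phi> ` H"
  then obtain x where x: "x \<in> H" "x \<in> G" "a = \<phi> x" using assms(3) by blast
  show "bij a" using x \<phi>(2) G_closed(2) by blast
  show "inv' a \<in> \<phi> ` H" using \<phi>(6)[OF x(2)] H(3)[OF x(1)] x(3) by (metis imageI)
  fix b assume "b \<in> \<phi> ` H"
  then obtain y where y: "y \<in> H" "y \<in> G" "b = \<phi> y" using assms(3) by blast
  show "a \<circ> b \<in> \<phi> ` H" using \<phi>(1)[OF x(2) y(2)] H(4)[OF x(1) y(1)] x(3) y(3) by (metis imageI)
qed

lemma virtually_contains_iso_image:
  assumes "\<phi> \<in> iso (grp G) (grp G)" "B \<subseteq> G" "virtually_contains A B"
  shows "virtually_contains (\<phi> ` A) (\<phi> ` B)"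
proof -
  note \<phi> = iso_facts[OF assms(1)]
  obtain f :: "_ \<Rightarrow> nat" where f: "finite (f ` B)"
    "\<And>x y. x \<in> B \<Longrightarrow> y \<in> B \<Longrightarrow> f x = f y \<Longrightarrow> x \<circ> inv' y \<in> A"
    using virtually_containsE[OF assms(3)] by blast
  have unwind: "inv_into G \<phi> (\<phi> x) = x" if "x \<in> B" for x
    by (rule inv_into_f_f[OF \<phi>(3)]) (use that assms(2) in blast)
  show ?thesis
  proof (rule virtually_containsI[of "\<lambda>a. f (inv_into G \<phi> a)"])
    have "(\<lambda>a. f (inv_into G \<phi> a)) ` \<phi> ` B \<subseteq> f ` B" using unwind by auto
    then show "finite ((\<lambda>a. f (inv_into G \<phi> a)) ` \<phi> ` B)" using f(1) by (rule finite_subset)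
    fix a b assume "a \<in> \<phi> ` B" "b \<in> \<phi> ` B" "f (inv_into G \<phi> a) = f (inv_into G \<phi> b)"
    then obtain x y where xy: "x \<in> B" "y \<in> B" "a = \<phi> x" "b = \<phi> y" "f x = f y"
      using unwind by auto
    then have G: "x \<in> G" "y \<in> G" "inv' y \<in> G" using assms(2) G_closed(3) by blast+
    have "a \<circ> inv' b = \<phi> (x \<circ> inv' y)"
      using \<phi>(1)[OF G(1,3)] \<phi>(6)[OF G(2)] xy by simp
    then show "a \<circ> inv' b \<in> \<phi> ` A" using f(2) xy by blast
  qed
qed

lemma iso_image_sstab_neq_pstab:
  assumes \<phi>: "\<phi> \<in> iso (grp G) (grp G)"
    and F: "finite F" "F \<subseteq> boundary" "\<xi> \<in> F" "\<not> F \<subseteq> {\<xi>}" and \<eta>: "\<eta> \<in> boundary"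
  shows "\<phi> ` sstab G F \<noteq> pstab G {\<eta>}"
proof
  assume eq: "\<phi> ` sstab G F = pstab G {\<eta>}"
  have \<xi>: "\<xi> \<in> boundary" using F by blast
  have sub: "pstab G {\<xi>} \<subseteq> G" "sstab G F \<subseteq> G" by (auto simp: pstab_def sstab_def)
  define W where "W = \<phi> ` pstab G {\<xi>}"
  have W: "perm_group W" "W \<subseteq> G"
    unfolding W_def using perm_group_iso_image[OF \<phi> perm_group_pstab sub(1)] sub iso_facts(2)[OF \<phi>]
    by auto
  \<comment> \<open>The pointwise stabilizer of \<open>F\<close> has finite index in the setwise one
    and lies in the stabilizer of \<open>\<xi>\<close>.\<close>
  have "virtually_contains (pstab G {\<xi>}) (sstab G F)"
    by (rule virtually_contains_mono[OF pstab_virtually_contains_sstab[OF F(1)]])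
      (use F in \<open>auto simp: pstab_def\<close>)
  then have vW: "virtually_contains W (pstab G {\<eta>})"
    using virtually_contains_iso_image[OF \<phi> sub(2)] by (simp add: W_def eq)
  have "W \<subseteq> pstab G {\<eta>}"
  proof (rule ccontr)
    assume "\<not> W \<subseteq> pstab G {\<eta>}"
    then have "\<exists>h\<in>W. h \<circ> \<eta> \<noteq> \<eta>" using W(2) by (auto simp: pstab_def)
    then have "virtually_contains W G"
      using virtually_contains_if_moves[of "{\<eta>}" W] \<eta> W vW by simp
    \<comment> \<open>Pulling back along the inverse of \<open>\<phi>\<close> would give the
      stabilizer of \<open>\<xi>\<close> finite index in \<open>G\<close>.\<close>
    then have "virtually_contains (inv_into G \<phi> ` W) (inv_into G \<phi> ` G)"
      using virtually_contains_iso_image[of "inv_into G \<phi>" G W]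
        group.iso_set_sym[OF group.subgroup_imp_group[OF group_AutT subgroup_G] \<phi>] by simp
    moreover have "inv_into G \<phi> ` W = pstab G {\<xi>}" "inv_into G \<phi> ` G = G"
      unfolding W_def using inv_into_image_cancel[OF iso_facts(3)[OF \<phi>]] sub(1) iso_facts(4)[OF \<phi>]
      by (simp, metis subset_refl)
    ultimately show False using not_virtually_contains_pstab[OF \<xi>] by simp
  qed
  \<comment> \<open>Injectivity of \<open>\<phi>\<close> on \<open>G\<close> turns the inclusion of
    images into one of the subgroups themselves.\<close>
  then have "pstab G {\<xi>} \<subseteq> sstab G F"
    unfolding W_def eq[symmetric] using inj_on_image_mem_iff[OF iso_facts(3)[OF \<phi>] _ sub(2)] sub(1)
    by blast
  then have "F \<subseteq> {\<xi>}" using pstab_subset_sstab_imp_subset[of "{\<xi>}" F] F \<xi> by simp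
  then show False using F(4) by simp
qed

end

section \<open>Orbits of \<open>Q\<close> and counting of classes\<close>

theorem corollary1p2:
  fixes G Q :: "('a::finite list \<Rightarrow> 'a list) set"
  assumes "card (UNIV :: 'a set) \<ge> 2"
    and "subgroup G AutT"
    and "finitely_generated (grp G)"
    and "regular_branch G"
    and "subgroup Q (grp G)"
    and "finite Q"
    and "\<not> (\<exists>\<xi>\<in>boundary. \<forall>q\<in>Q. q \<circ> \<xi> = \<xi>)"
  shows "\<exists>\<C>. \<C> \<subseteq> {H. weakly_maximal H (grp G)} // aut_equiv (grp G) \<and> uncountable \<C> \<and>
           \<C> \<inter> {P. parabolic P G} // aut_equiv (grp G) = {}"
proof -
  obtain K where "branch_group G K"
    using regular_branch_imp_branch_group[OF assms(1,2,4)] by blast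
  then interpret branch_group G K .
  let ?r = "aut_equiv (grp G)"
  have grp: "group (grp G)" by (rule group.subgroup_imp_group[OF group_AutT subgroup_G])
  have Q: "Q \<subseteq> G" "perm_group Q" using assms(5) subgroup_grp_iff[OF subgroup_G] by auto
  note QD = perm_groupD[OF Q(2)]
  define orb where "orb \<xi> = (\<lambda>q. q \<circ> \<xi>) ` Q" for \<xi> :: "nat \<Rightarrow> 'a list"
  have orb_fin: "finite (orb \<xi>)" for \<xi> using assms(6) by (simp add: orb_def)
  have orb_self: "\<xi> \<in> orb \<xi>" for \<xi> using QD(1) by (auto simp: orb_def image_iff intro!: bexI[of _ id])
  have orb_bd: "orb \<xi> \<subseteq> boundary" if "\<xi> \<in> boundary" for \<xi>
    using that Q(1) tree_G tree_automorphism_boundary by (auto simp: orb_def subset_iff)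
  have Q_sub: "q \<in> sstab G (orb \<xi>)" if q: "q \<in> Q" for q \<xi>
  proof -
    have qG: "q \<in> G" "inv' q \<in> Q" using q Q(1) QD(3) by auto
    have "p \<circ> \<xi> \<in> (\<circ>) q ` orb \<xi>" if "p \<in> Q" for p
    proof (rule image_eqI)
      show "p \<circ> \<xi> = q \<circ> ((inv' q \<circ> p) \<circ> \<xi>)" using qG(1) by (simp add: comp_assoc)
      show "(inv' q \<circ> p) \<circ> \<xi> \<in> orb \<xi>" using QD(4) qG(2) that by (auto simp: orb_def)
    qed
    moreover have "q \<circ> (p \<circ> \<xi>) \<in> orb \<xi>" if "p \<in> Q" for p
      using QD(4)[OF q that] by (auto simp: orb_def comp_assoc[symmetric])
    ultimately show ?thesis using qG(1) by (auto simp: sstab_def orb_def)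
  qed
  define W where "W \<xi> = sstab G (orb \<xi>)" for \<xi>
  have wm: "weakly_maximal (W \<xi>) (grp G)" if "\<xi> \<in> boundary" for \<xi>
    unfolding W_def
  proof (rule weakly_maximal_sstab[OF orb_fin orb_bd[OF that]])
    fix \<zeta> \<eta> assume "\<zeta> \<in> orb \<xi>" "\<eta> \<in> orb \<xi>"
    then obtain p q where pq: "p \<in> Q" "q \<in> Q" "\<zeta> = p \<circ> \<xi>" "\<eta> = q \<circ> \<xi>" by (auto simp: orb_def)
    have pG: "p \<in> G" using pq Q(1) by blast
    have "(q \<circ> inv' p) \<circ> \<zeta> = \<eta>" using pq pG by (simp add: comp_assoc)
    then show "\<exists>k\<in>sstab G (orb \<xi>). k \<circ> \<zeta> = \<eta>" using Q_sub QD(3,4) pq by blast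
  qed (use orb_self in blast)
  have sub: "subgroup (W \<xi>) (grp G)" for \<xi>
    using perm_group_sstab subgroup_grp_iff[OF subgroup_G] by (auto simp: W_def sstab_def)
  define \<C> where "\<C> = (\<lambda>\<xi>. ?r `` {W \<xi>}) ` boundary"
  have "\<C> \<subseteq> {H. weakly_maximal H (grp G)} // ?r"
    using wm by (auto simp: \<C>_def intro: quotientI)
  moreover have "uncountable \<C>"
  proof
    assume "countable \<C>"
    \<comment> \<open>Countably many classes, each countable, would leave only countably many groups
      \<open>W \<xi>\<close>.\<close>
    then have "countable (\<Union>H\<in>\<C>. H)"
      by (rule countable_UN) (auto simp: \<C>_def intro: countable_aut_class[OF grp assms(3)])
    moreover have "W ` boundary \<subseteq> (\<Union>H\<in>\<C>. H)"
      using equiv_class_self[OF equiv_aut_equiv[OF grp]] sub by (auto simp: \<C>_def)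
    ultimately have cW: "countable (W ` boundary)" by (meson countable_subset)
    \<comment> \<open>Rays with the same stabilizer have the same orbit, so the union is over a
      single set and \<open>inv_W\<close> recovers the orbit.\<close>
    define inv_W where "inv_W H = \<Union>{orb \<xi> |\<xi>. \<xi> \<in> boundary \<and> W \<xi> = H}" for H
    have "inv_W (W \<xi>) = orb \<xi>" if "\<xi> \<in> boundary" for \<xi>
    proof -
      have "orb \<zeta> = orb \<xi>" if "\<zeta> \<in> boundary" "W \<zeta> = W \<xi>" for \<zeta>
      proof (rule subset_antisym)
        note bd = orb_bd[OF that(1)] orb_bd[OF \<open>\<xi> \<in> boundary\<close>]
        note imp = pstab_subset_sstab_imp_subset[OF orb_fin _ orb_fin]
        show "orb \<zeta> \<subseteq> orb \<xi>"
          by (rule imp[OF bd(2,1)]) (use pstab_subset_sstab that(2) in \<open>simp add: W_def\<close>)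
        show "orb \<xi> \<subseteq> orb \<zeta>"
          by (rule imp[OF bd]) (use pstab_subset_sstab that(2)[symmetric] in \<open>simp add: W_def\<close>)
      qed
      then have "{orb \<zeta> |\<zeta>. \<zeta> \<in> boundary \<and> W \<zeta> = W \<xi>} = {orb \<xi>}" using that by blast
      then show ?thesis by (simp add: inv_W_def)
    qed
    \<comment> \<open>The rays would be covered by countably many finite orbits.\<close>
    then have "boundary \<subseteq> \<Union>(inv_W ` W ` boundary)" "\<And>H. H \<in> W ` boundary \<Longrightarrow> finite (inv_W H)"
      using orb_self orb_fin by auto
    then have "countable (boundary :: (nat \<Rightarrow> 'a list) set)"
      using cW by (meson countable_UN countable_finite countable_subset)
    then show False using uncountable_boundary[OF card2] by contradiction
  qed
  moreover have "\<C> \<inter> {P. parabolic P G} // ?r = {}"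
  proof (rule ccontr)
    assume "\<C> \<inter> {P. parabolic P G} // ?r \<noteq> {}"
    then obtain \<xi> \<eta> where x: "\<xi> \<in> boundary" "\<eta> \<in> boundary"
      "?r `` {W \<xi>} = ?r `` {boundary_stab G \<eta>}"
      by (auto simp: \<C>_def parabolic_def elim!: quotientE)
    have "(W \<xi>, boundary_stab G \<eta>) \<in> ?r"
      using eq_equiv_class[OF x(3) equiv_aut_equiv[OF grp]] subgroup_boundary_stab[OF subgroup_G]
      by simp
    then obtain \<phi> where \<phi>: "\<phi> \<in> iso (grp G) (grp G)" "\<phi> ` sstab G (orb \<xi>) = pstab G {\<eta>}"
      by (auto simp: aut_equiv_def W_def boundary_stab_eq_pstab)
    \<comment> \<open>Since \<open>Q\<close> fixes no ray, the orbit has a second element.\<close>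
    obtain q where "q \<in> Q" "q \<circ> \<xi> \<noteq> \<xi>" using assms(7) x(1) by blast
    then have "\<not> orb \<xi> \<subseteq> {\<xi>}" by (auto simp: orb_def)
    then show False
      using iso_image_sstab_neq_pstab[OF \<phi>(1) orb_fin orb_bd[OF x(1)] orb_self _ x(2)] \<phi>(2) by blast
  qed
  ultimately show ?thesis by blast
qed

end
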